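(* Let $F\in\mathbb{R}^{M\times N}$, $\mathbf{y}\in\mathbb{R}^M$, and let $R\in\mathbb{R}^{K\times N}$ satisfy $\ker(F)\cap\ker(R)=\{\mathbf{0}_N\}$. Let $r,\tilde r\in\mathbb{R}\setminus\{0\}$, $\beta,\tilde\beta>0$, $\vartheta_1,\dots,\vartheta_K>0$, $\tilde\vartheta>0$, and set $\eta=r\beta-\tfrac32$ and $\tilde\eta=\tilde r\tilde\beta-\tfrac{M+2}{2}$. Let $\mathcal{G}(\mathbf{x},\boldsymbol{\theta},\nu)$ be the objective function defined in the context. 1. If $r,\tilde r\ge 1$ and $\eta,\tilde\eta>0$, then $\mathcal{G}$ is globally strictly convex. 2. Assume that both of the following hold: (a) either ($0<r<1$ and $\eta>0$) or $r<0$; (b) either ($0<\tilde r<1$ and $\tilde\eta>0$) or $\tilde r<0$. Then $\mathcal{G}$ is locally convex at $(\mathbf{x},\boldsymbol{\theta},\nu)\in\mathbb{R}^N\times\mathbb{R}_{++}^K\times\mathbb{R}_{++}$ provided that $$\theta_i<\vartheta_i\left(\frac{\eta}{r|r-1|}\right)^{1/r}\ (i=1,\dots,K)\quad\text{and}\quad \nu<\tilde\vartheta\left(\frac{\tilde\eta}{\tilde r|\tilde r-1|}\right)^{1/\tilde r}.$$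
   Context: $\mathbb{R}_{++}$ denotes the positive reals. For a vector $\boldsymbol{\theta}$, $D_{\boldsymbol{\theta}}=\operatorname{diag}(\theta_1,\dots,\theta_K)$. The objective $\mathcal{G}:\mathbb{R}^N\times\mathbb{R}^K\times\mathbb{R}\to\mathbb{R}\cup\{+\infty\}$ is $$\mathcal{G}(\mathbf{x},\boldsymbol{\theta},\nu)=\frac{1}{2\nu}\|F\mathbf{x}-\mathbf{y}\|_2^2+\frac12\|D_{\boldsymbol{\theta}}^{-1/2}R\mathbf{x}\|_2^2+\left(\frac{\nu}{\tilde\vartheta}\right)^{\tilde r}+\sum_{i=1}^K\left(\frac{\theta_i}{\vartheta_i}\right)^r-\tilde\eta\log\nu-\eta\sum_{i=1}^K\log\theta_i$$ if $\nu>0$ and all $\theta_i>0$, and $\mathcal{G}=+\infty$ otherwise. "Globally strictly convex" means strictly convex on the effective domain $\mathbb{R}^N\times\mathbb{R}_{++}^K\times\mathbb{R}_{++}$. "Locally convex at a point" means convex on some neighborhood of that point. *)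

theory Defs
  imports "HOL-Analysis.Analysis"
begin

definition diag_matrix :: "real ^ 'n \<Rightarrow> real ^ 'n ^ 'n" where
  "diag_matrix d = (\<chi> i j. if i = j then d $ i else 0)"

text \<open>The objective, as an extended-real-valued function on the whole product space.  The matrix
  \<open>diag_matrix (\<chi> i. (\<theta> $ i) powr (-1/2))\<close> is the inverse square root of
  \<open>diag_matrix \<theta>\<close>; it is only used where all \<open>\<theta> $ i\<close> are positive.
  The scale parameters are \<open>\<tau>\<close> (for \<open>\<theta>\<close>) and \<open>\<tau>'\<close> (for \<open>\<nu>\<close>).\<close>

definition objective ::
  "real ^ 'n ^ 'm \<Rightarrow> real ^ 'n ^ 'k \<Rightarrow> real ^ 'm \<Rightarrow> real \<Rightarrow> real \<Rightarrow> real ^ 'k \<Rightarrow> real \<Rightarrow> real \<Rightarrow> real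
    \<Rightarrow> (real ^ 'n) \<times> (real ^ 'k) \<times> real \<Rightarrow> ereal" where
  "objective F R y r r' \<tau> \<tau>' \<eta> \<eta>' = (\<lambda>(x, \<theta>, \<nu>).
     if \<nu> > 0 \<and> (\<forall>i. \<theta> $ i > 0) then
       ereal (1 / (2 * \<nu>) * (norm (F *v x - y))\<^sup>2
            + 1 / 2 * (norm (diag_matrix (\<chi> i. (\<theta> $ i) powr (-1/2)) *v (R *v x)))\<^sup>2
            + (\<nu> / \<tau>') powr r'
            + (\<Sum>i\<in>UNIV. (\<theta> $ i / \<tau> $ i) powr r)
            - \<eta>' * ln \<nu>
            - \<eta> * (\<Sum>i\<in>UNIV. ln (\<theta> $ i)))
     else \<infinity>)"

definition effective_domain :: "('a \<Rightarrow> ereal) \<Rightarrow> 'a set" where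
  "effective_domain f = {z. f z < \<infinity>}"

text \<open>The library's \<open>convex_on\<close> is for real-valued functions only.  Here the weights are
  strictly positive, so no product of zero and infinity occurs.\<close>

definition ereal_convex_on :: "'a::real_vector set \<Rightarrow> ('a \<Rightarrow> ereal) \<Rightarrow> bool" where
  "ereal_convex_on S f \<longleftrightarrow> convex S \<and>
     (\<forall>x\<in>S. \<forall>y\<in>S. \<forall>u>0. \<forall>v>0. u + v = 1 \<longrightarrow>
        f (u *\<^sub>R x + v *\<^sub>R y) \<le> ereal u * f x + ereal v * f y)"

definition ereal_strictly_convex_on :: "'a::real_vector set \<Rightarrow> ('a \<Rightarrow> ereal) \<Rightarrow> bool" where
  "ereal_strictly_convex_on S f \<longleftrightarrow> convex S \<and>
     (\<forall>x\<in>S. \<forall>y\<in>S. x \<noteq> y \<longrightarrow> (\<forall>u>0. \<forall>v>0. u + v = 1 \<longrightarrow>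
        f (u *\<^sub>R x + v *\<^sub>R y) < ereal u * f x + ereal v * f y))"

definition globally_strictly_convex :: "('a::real_vector \<Rightarrow> ereal) \<Rightarrow> bool" where
  "globally_strictly_convex f \<longleftrightarrow> ereal_strictly_convex_on (effective_domain f) f"

definition locally_convex_at :: "('a::real_normed_vector \<Rightarrow> ereal) \<Rightarrow> 'a \<Rightarrow> bool" where
  "locally_convex_at f z \<longleftrightarrow> (\<exists>U. open U \<and> z \<in> U \<and> ereal_convex_on U f)"

lemma effective_domain_objective:
  "effective_domain (objective F R y r r' \<tau> \<tau>' \<eta> \<eta>') = UNIV \<times> {\<theta>. \<forall>i. \<theta> $ i > 0} \<times> {0<..}"
  by (auto simp: effective_domain_def objective_def split: if_splits)

lemma ereal_convex_on_real_iff: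
  "ereal_convex_on S (\<lambda>x. ereal (f x)) \<longleftrightarrow> convex_on S f"
proof
  assume h: "ereal_convex_on S (\<lambda>x. ereal (f x))"
  show "convex_on S f"
    unfolding convex_on_def
  proof (intro conjI ballI allI impI)
    show "convex S" using h by (simp add: ereal_convex_on_def)
    fix x y u v assume *: "x \<in> S" "y \<in> S" "0 \<le> (u::real)" "0 \<le> (v::real)" "u + v = 1"
    show "f (u *\<^sub>R x + v *\<^sub>R y) \<le> u * f x + v * f y"
    proof (cases "u = 0 \<or> v = 0")
      case True
      then show ?thesis using * by auto
    next
      case False
      then have "u > 0" "v > 0" using * by auto
      then show ?thesis using h * by (simp add: ereal_convex_on_def)
    qed
  qed
next
  assume "convex_on S f"
  then show "ereal_convex_on S (\<lambda>x. ereal (f x))"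
    by (simp add: ereal_convex_on_def convex_on_def)
qed

end

theory Submission
  imports Defs
begin

text \<open>
  On its effective domain the objective splits into perspective terms \<open>\<parallel>a\<parallel>\<^sup>2 / s\<close>, in which
  \<open>a\<close> depends affinely on \<open>x\<close> and \<open>s\<close> is one of the variances \<open>\<nu>\<close>, \<open>\<theta> $ i\<close>, and one scalar
  penalty \<open>(t / \<tau>) powr r - \<eta> * ln t\<close> per variance.

  The perspective terms are jointly convex in \<open>(a, s)\<close> for all parameters; the exact Jensen gap
  (\<open>quad_over_linear_gap\<close>) even shows that equality forces \<open>a / s\<close> to agree at both points.
  So only the penalties decide about convexity, and
  these are functions of one variable whose second derivative is
  \<open>(r * (r - 1) * (t / \<tau>) powr r + \<eta>) / t\<^sup>2\<close>.

  If \<open>r \<ge> 1\<close> and \<open>\<eta> > 0\<close>, the power is convex and the logarithm makes each penalty strictly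
  convex.  Hence two points with different variances give a strict Jensen inequality through a
  penalty.  Two points with the same variances differ in \<open>x\<close>, so the trivial
  intersection of the kernels makes \<open>F *v x\<close> or \<open>R *v x\<close> differ, and the inequality is strict
  through a perspective term.

  If \<open>r < 1\<close> and \<open>\<eta>\<close> has the sign of \<open>r\<close>, the bound imposed on a variance \<open>t\<close> says exactly that
  the second derivative is positive at \<open>t\<close>, and smaller variances satisfy it too
  (\<open>convex_on_penalty_below_threshold\<close>).  The objective is
  therefore convex on the open convex box that all these bounds cut out, which is the required
  neighbourhood.
\<close>

section \<open>The perspective of the squared norm\<close>

text \<open>The gap is a square: it becomes visible after clearing denominators, since both sides are
  quadratic forms in \<open>a\<close> and \<open>b\<close>.\<close>

lemma quad_over_linear_gap:
  fixes a b :: "'a::real_inner" and s t u v :: real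
  assumes "s > 0" "t > 0" "u * s + v * t > 0"
  shows "u * ((norm a)\<^sup>2 / s) + v * ((norm b)\<^sup>2 / t)
       - (norm (u *\<^sub>R a + v *\<^sub>R b))\<^sup>2 / (u * s + v * t)
       = u * v * (norm (t *\<^sub>R a - s *\<^sub>R b))\<^sup>2 / (s * t * (u * s + v * t))"
proof -
  define m where "m = u * s + v * t"
  have m: "m > 0" using assms by (simp add: m_def)
  have 1: "(norm (u *\<^sub>R a + v *\<^sub>R b))\<^sup>2 = u\<^sup>2 * (a \<bullet> a) + 2 * u * v * (a \<bullet> b) + v\<^sup>2 * (b \<bullet> b)"
    unfolding power2_norm_eq_inner
    by (simp add: inner_simps inner_commute[of b a] power2_eq_square algebra_simps)
  have 2: "(norm (t *\<^sub>R a - s *\<^sub>R b))\<^sup>2 = t\<^sup>2 * (a \<bullet> a) - 2 * s * t * (a \<bullet> b) + s\<^sup>2 * (b \<bullet> b)"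
    unfolding power2_norm_eq_inner
    by (simp add: inner_simps inner_commute[of b a] power2_eq_square algebra_simps)
  have "(u * t * (a \<bullet> a) + v * s * (b \<bullet> b)) * m
        - s * t * (u\<^sup>2 * (a \<bullet> a) + 2 * u * v * (a \<bullet> b) + v\<^sup>2 * (b \<bullet> b))
      = u * v * (t\<^sup>2 * (a \<bullet> a) - 2 * s * t * (a \<bullet> b) + s\<^sup>2 * (b \<bullet> b))"
    unfolding m_def by algebra
  then show ?thesis
    unfolding 1 2 m_def[symmetric] unfolding power2_norm_eq_inner
    using assms(1,2) m by (simp add: field_simps)
qed

lemma quad_over_linear_jensen:
  fixes a b :: "'a::real_inner" and s t u v :: real
  assumes "s > 0" "t > 0" "u > 0" "v > 0"
  shows "(norm (u *\<^sub>R a + v *\<^sub>R b))\<^sup>2 / (u * s + v * t)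
       \<le> u * ((norm a)\<^sup>2 / s) + v * ((norm b)\<^sup>2 / t)"
proof -
  have m: "u * s + v * t > 0" using assms by (simp add: add_pos_pos)
  have "0 \<le> u * v * (norm (t *\<^sub>R a - s *\<^sub>R b))\<^sup>2 / (s * t * (u * s + v * t))"
    using assms m by (intro divide_nonneg_pos) auto
  then show ?thesis
    using quad_over_linear_gap[OF assms(1,2) m, of a b] by simp
qed

lemma quad_over_linear_strict_jensen:
  fixes a b :: "'a::real_inner" and s t u v :: real
  assumes "s > 0" "t > 0" "u > 0" "v > 0" "t *\<^sub>R a \<noteq> s *\<^sub>R b"
  shows "(norm (u *\<^sub>R a + v *\<^sub>R b))\<^sup>2 / (u * s + v * t)
       < u * ((norm a)\<^sup>2 / s) + v * ((norm b)\<^sup>2 / t)"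
proof -
  have m: "u * s + v * t > 0" using assms by (simp add: add_pos_pos)
  have "0 < u * v * (norm (t *\<^sub>R a - s *\<^sub>R b))\<^sup>2 / (s * t * (u * s + v * t))"
    using assms m by (intro divide_pos_pos mult_pos_pos) auto
  then show ?thesis
    using quad_over_linear_gap[OF assms(1,2) m, of a b] by simp
qed

section \<open>The scalar penalty\<close>

definition penalty :: "real \<Rightarrow> real \<Rightarrow> real \<Rightarrow> real \<Rightarrow> real" where
  "penalty r \<tau> \<eta> t = (t / \<tau>) powr r - \<eta> * ln t"

lemma convex_on_penalty:
  assumes "convex I" "I \<subseteq> {0<..}" "\<tau> > 0"
    and pos: "\<And>t. t \<in> I \<Longrightarrow> 0 \<le> r * (r - 1) * (t / \<tau>) powr r + \<eta>"
  shows "convex_on I (penalty r \<tau> \<eta>)"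
proof (rule f''_ge0_imp_convex[OF assms(1)])
  fix t assume "t \<in> I"
  then have t: "t > 0" using assms(2) by auto
  have power: "((\<lambda>t. (t / \<tau>) powr q) has_real_derivative q / \<tau> * (t / \<tau>) powr (q - 1)) (at t)" for q
    using DERIV_chain2[OF has_real_derivative_powr[OF divide_pos_pos[OF t \<open>\<tau> > 0\<close>]]
      DERIV_cdivide[OF DERIV_ident]] by simp
  show "(penalty r \<tau> \<eta> has_real_derivative r / \<tau> * (t / \<tau>) powr (r - 1) - \<eta> / t) (at t)"
    unfolding penalty_def[abs_def]
    using DERIV_diff[OF power[of r] DERIV_cmult[OF DERIV_ln_divide[OF t]]] by simp
  have "((\<lambda>t. r / \<tau> * (t / \<tau>) powr (r - 1) - \<eta> / t) has_real_derivative
          r / \<tau> * ((r - 1) / \<tau> * (t / \<tau>) powr (r - 1 - 1)) + \<eta> / t\<^sup>2) (at t)"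
    using t \<open>\<tau> > 0\<close> by (auto intro!: derivative_eq_intros simp: power2_eq_square)
  moreover have "(t / \<tau>) powr (r - 1 - 1) = (t / \<tau>) powr r * (\<tau>\<^sup>2 / t\<^sup>2)"
    using t \<open>\<tau> > 0\<close> by (simp add: powr_diff power2_eq_square)
  ultimately show "((\<lambda>t. r / \<tau> * (t / \<tau>) powr (r - 1) - \<eta> / t) has_real_derivative
          (r * (r - 1) * (t / \<tau>) powr r + \<eta>) / t\<^sup>2) (at t)"
    using \<open>\<tau> > 0\<close> by (simp add: add_divide_distrib power2_eq_square mult_ac)
  show "0 \<le> (r * (r - 1) * (t / \<tau>) powr r + \<eta>) / t\<^sup>2"
    using pos[OF \<open>t \<in> I\<close>] by simp
qed

text \<open>The tangent to \<open>ln\<close> at the weighted mean lies strictly above \<open>ln\<close> at \<open>s\<close> and at \<open>t\<close>, and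
  the weighted mean of the two tangent values is the value at the mean.\<close>

lemma ln_strict_jensen:
  fixes s t u v :: real
  assumes "s > 0" "t > 0" "s \<noteq> t" "u > 0" "v > 0" "u + v = 1"
  shows "u * ln s + v * ln t < ln (u * s + v * t)"
proof -
  define m where "m = u * s + v * t"
  have m: "m > 0" unfolding m_def using assms by (simp add: add_pos_pos)
  have v: "v = 1 - u" using assms(6) by simp
  have "m - s = v * (t - s)" "m - t = u * (s - t)" by (simp_all add: m_def v algebra_simps)
  then have ne: "s \<noteq> m" "t \<noteq> m" using assms by auto
  have tangent: "ln w < ln m + (w - m) / m" if "w > 0" "w \<noteq> m" for w
    using ln_diff_less[OF that(1) m that(2)] by simp
  have "u * ln s + v * ln t < u * (ln m + (s - m) / m) + v * (ln m + (t - m) / m)"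
    using tangent[OF assms(1) ne(1)] tangent[OF assms(2) ne(2)] assms(4,5)
    by (intro add_strict_mono mult_strict_left_mono)
  also have "\<dots> = (u + v) * ln m + (u * s + v * t - (u + v) * m) / m"
    by (simp add: distrib_left distrib_right diff_divide_distrib add_divide_distrib right_diff_distrib)
  also have "\<dots> = ln m" by (simp add: assms(6) flip: m_def)
  finally show ?thesis by (simp add: m_def)
qed

lemma penalty_strict_jensen:
  assumes "r \<ge> 1" "\<eta> > 0" "\<tau> > 0" "s > 0" "t > 0" "s \<noteq> t" "u > 0" "v > 0" "u + v = 1"
  shows "penalty r \<tau> \<eta> (u * s + v * t) < u * penalty r \<tau> \<eta> s + v * penalty r \<tau> \<eta> t"
proof -
  have split: "penalty r \<tau> \<eta> w = penalty r \<tau> 0 w - \<eta> * ln w" for w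
    by (simp add: penalty_def)
  have "convex_on {0<..} (penalty r \<tau> 0)"
    using assms(1,3) by (intro convex_on_penalty) auto
  then have "penalty r \<tau> 0 (u * s + v * t) \<le> u * penalty r \<tau> 0 s + v * penalty r \<tau> 0 t"
    using assms unfolding convex_on_def by auto
  moreover have "\<eta> * (u * ln s + v * ln t) < \<eta> * ln (u * s + v * t)"
    using ln_strict_jensen[of s t u v] assms by simp
  ultimately show ?thesis
    unfolding split by (simp add: algebra_simps)
qed

text \<open>Put \<open>q = \<eta> / (r * (1 - r))\<close>, which is positive in both cases.  The numerator of the second
  derivative is \<open>r * (1 - r) * (q - (t / \<tau>) powr r)\<close>.  Raising the bound
  \<open>t / \<tau> < q powr (1 / r)\<close> to the power \<open>r\<close> keeps the inequality for \<open>r > 0\<close> and reverses it for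
  \<open>r < 0\<close>, so the last factor always has the sign of \<open>r * (1 - r)\<close>.\<close>

lemma convex_on_penalty_below_threshold:
  assumes r: "(0 < r \<and> r < 1 \<and> \<eta> > 0) \<or> (r < 0 \<and> \<eta> < 0)" and \<tau>: "\<tau> > 0"
  shows "convex_on {0<..<\<tau> * (\<eta> / (r * \<bar>r - 1\<bar>)) powr (1 / r)} (penalty r \<tau> \<eta>)"
proof (rule convex_on_penalty)
  define q where "q = \<eta> / (r * (1 - r))"
  have abs: "\<bar>r - 1\<bar> = 1 - r" using r by auto
  have q: "q > 0" unfolding q_def using r by (auto simp: zero_less_divide_iff zero_less_mult_iff mult_less_0_iff)
  have \<eta>: "\<eta> = q * (r * (1 - r))" unfolding q_def using r by auto
  fix t assume "t \<in> {0<..<\<tau> * (\<eta> / (r * \<bar>r - 1\<bar>)) powr (1 / r)}"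
  then have t: "0 < t / \<tau>" "t / \<tau> < q powr (1 / r)"
    using \<tau> by (simp_all add: abs q_def field_simps)
  have qr: "(q powr (1 / r)) powr r = q" using r q by (auto simp: powr_powr)
  have eq: "r * (r - 1) * (t / \<tau>) powr r + \<eta> = r * (1 - r) * (q - (t / \<tau>) powr r)"
    unfolding \<eta> by (simp add: algebra_simps)
  show "0 \<le> r * (r - 1) * (t / \<tau>) powr r + \<eta>"
  proof (cases "r > 0")
    case True
    then have "(t / \<tau>) powr r < q" using powr_less_mono2[of r "t / \<tau>" "q powr (1 / r)"] t qr by simp
    then show ?thesis unfolding eq using True r by simp
  next
    case False
    then have "r < 0" using r by auto
    then have "q < (t / \<tau>) powr r" using powr_less_mono2_neg[of r "t / \<tau>" "q powr (1 / r)"] t qr by simp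
    then show ?thesis unfolding eq using \<open>r < 0\<close> by (simp add: mult_nonpos_nonpos mult_nonpos_nonneg)
  qed
qed (use \<tau> in auto)

section \<open>Decomposition of the objective\<close>

lemma norm_diag_inv_sqrt:
  fixes \<theta> w :: "real ^ 'k"
  assumes "\<And>i. \<theta> $ i > 0"
  shows "(norm (diag_matrix (\<chi> i. (\<theta> $ i) powr (-1/2)) *v w))\<^sup>2 = (\<Sum>i\<in>UNIV. (w $ i)\<^sup>2 / \<theta> $ i)"
proof -
  have "(diag_matrix d *v w) $ i = d $ i * w $ i" for d :: "real ^ 'k" and i
    by (simp add: diag_matrix_def matrix_vector_mult_def if_distrib[of "\<lambda>z. z * _"] cong: if_cong)
  moreover have "((\<theta> $ i) powr (-1/2))\<^sup>2 = 1 / \<theta> $ i" for i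
    using assms[of i] by (simp add: power2_eq_square powr_minus_divide flip: powr_add)
  ultimately show ?thesis
    by (simp add: power2_norm_eq_inner inner_vec_def power_mult_distrib flip: power2_eq_square)
qed

text \<open>The absolute value of \<open>(R *v x) $ i\<close> is written as a norm so that the scalar terms and the
  data term are instances of the same inequality.\<close>

definition perspective_part ::
  "real ^ 'n ^ 'm \<Rightarrow> real ^ 'n ^ 'k \<Rightarrow> real ^ 'm \<Rightarrow> (real ^ 'n) \<times> (real ^ 'k) \<times> real \<Rightarrow> real" where
  "perspective_part F R y = (\<lambda>(x, \<theta>, \<nu>).
     (norm (F *v x - y))\<^sup>2 / \<nu> + (\<Sum>i\<in>UNIV. (norm ((R *v x) $ i))\<^sup>2 / \<theta> $ i))"

definition penalty_part ::
  "real \<Rightarrow> real \<Rightarrow> real ^ 'k \<Rightarrow> real \<Rightarrow> real \<Rightarrow> real \<Rightarrow> 'a \<times> (real ^ 'k) \<times> real \<Rightarrow> real" where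
  "penalty_part r r' \<tau> \<tau>' \<eta> \<eta>' = (\<lambda>(x, \<theta>, \<nu>).
     penalty r' \<tau>' \<eta>' \<nu> + (\<Sum>i\<in>UNIV. penalty r (\<tau> $ i) \<eta> (\<theta> $ i)))"

lemma objective_eq:
  assumes "\<And>i. \<theta> $ i > 0" "\<nu> > 0"
  shows "objective F R y r r' \<tau> \<tau>' \<eta> \<eta>' (x, \<theta>, \<nu>)
       = ereal (perspective_part F R y (x, \<theta>, \<nu>) / 2 + penalty_part r r' \<tau> \<tau>' \<eta> \<eta>' (x, \<theta>, \<nu>))"
  using assms
  by (simp add: objective_def perspective_part_def penalty_part_def penalty_def norm_diag_inv_sqrt[simplified]
      sum_subtractf sum_distrib_left add_divide_distrib sum_divide_distrib mult.commute[of 2])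

lemma perspective_part_jensen:
  fixes F :: "real ^ 'n ^ 'm" and R :: "real ^ 'n ^ 'k" and y :: "real ^ 'm"
  assumes pos: "\<And>i. \<theta>1 $ i > 0" "\<nu>1 > 0" "\<And>i. \<theta>2 $ i > 0" "\<nu>2 > 0"
    and uv: "u > 0" "v > 0" "u + v = 1"
  shows "perspective_part F R y (u *\<^sub>R (x1, \<theta>1, \<nu>1) + v *\<^sub>R (x2, \<theta>2, \<nu>2))
       \<le> u * perspective_part F R y (x1, \<theta>1, \<nu>1) + v * perspective_part F R y (x2, \<theta>2, \<nu>2)"
    (is ?le)
    and "\<lbrakk>\<theta>1 = \<theta>2; \<nu>1 = \<nu>2; F *v x1 \<noteq> F *v x2 \<or> R *v x1 \<noteq> R *v x2\<rbrakk> \<Longrightarrow>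
       perspective_part F R y (u *\<^sub>R (x1, \<theta>1, \<nu>1) + v *\<^sub>R (x2, \<theta>2, \<nu>2))
       < u * perspective_part F R y (x1, \<theta>1, \<nu>1) + v * perspective_part F R y (x2, \<theta>2, \<nu>2)"
proof -
  have "u *\<^sub>R y + v *\<^sub>R y = y" using uv(3) by (simp flip: scaleR_left_distrib)
  then have F_affine: "F *v (u *\<^sub>R x1 + v *\<^sub>R x2) - y = u *\<^sub>R (F *v x1 - y) + v *\<^sub>R (F *v x2 - y)"
    by (simp add: matrix_vector_right_distrib matrix_vector_mult_scaleR scaleR_diff_right algebra_simps)
  have R_linear: "(R *v (u *\<^sub>R x1 + v *\<^sub>R x2)) $ i = u *\<^sub>R (R *v x1) $ i + v *\<^sub>R (R *v x2) $ i" for i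
    by (simp add: matrix_vector_right_distrib matrix_vector_mult_scaleR)
  define fl fr where
    "fl = (norm (u *\<^sub>R (F *v x1 - y) + v *\<^sub>R (F *v x2 - y)))\<^sup>2 / (u * \<nu>1 + v * \<nu>2)" and
    "fr = u * ((norm (F *v x1 - y))\<^sup>2 / \<nu>1) + v * ((norm (F *v x2 - y))\<^sup>2 / \<nu>2)"
  define rl rr where
    "rl i = (norm (u *\<^sub>R (R *v x1) $ i + v *\<^sub>R (R *v x2) $ i))\<^sup>2 / (u * \<theta>1 $ i + v * \<theta>2 $ i)" and
    "rr i = u * ((norm ((R *v x1) $ i))\<^sup>2 / \<theta>1 $ i) + v * ((norm ((R *v x2) $ i))\<^sup>2 / \<theta>2 $ i)" for i
  have lhs: "perspective_part F R y (u *\<^sub>R (x1, \<theta>1, \<nu>1) + v *\<^sub>R (x2, \<theta>2, \<nu>2)) = fl + sum rl UNIV"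
    unfolding perspective_part_def fl_def rl_def by (simp only: scaleR_Pair add_Pair case_prod_conv F_affine R_linear) simp
  have rhs: "u * perspective_part F R y (x1, \<theta>1, \<nu>1) + v * perspective_part F R y (x2, \<theta>2, \<nu>2)
      = fr + sum rr UNIV"
    by (simp add: perspective_part_def fr_def rr_def sum.distrib sum_distrib_left algebra_simps)
  have f: "fl \<le> fr" unfolding fl_def fr_def by (intro quad_over_linear_jensen pos uv)
  have r: "rl i \<le> rr i" for i unfolding rl_def rr_def by (intro quad_over_linear_jensen pos uv)
  have rs: "sum rl UNIV \<le> sum rr UNIV" using r by (intro sum_mono) auto
  show ?le unfolding lhs rhs using f rs by simp
  assume eq: "\<theta>1 = \<theta>2" "\<nu>1 = \<nu>2" and ne: "F *v x1 \<noteq> F *v x2 \<or> R *v x1 \<noteq> R *v x2"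
  have "fl < fr \<or> sum rl UNIV < sum rr UNIV"
  proof (cases "F *v x1 = F *v x2")
    case False
    then have "fl < fr"
      unfolding fl_def fr_def using pos eq by (intro quad_over_linear_strict_jensen pos uv) auto
    then show ?thesis ..
  next
    case True
    then obtain i where "(R *v x1) $ i \<noteq> (R *v x2) $ i" using ne by (auto simp: vec_eq_iff)
    then have "rl i < rr i"
      unfolding rl_def rr_def using pos(3)[of i] eq
      by (intro quad_over_linear_strict_jensen pos uv) auto
    then show ?thesis using r by (auto intro!: sum_strict_mono_ex1)
  qed
  then show "perspective_part F R y (u *\<^sub>R (x1, \<theta>1, \<nu>1) + v *\<^sub>R (x2, \<theta>2, \<nu>2))
       < u * perspective_part F R y (x1, \<theta>1, \<nu>1) + v * perspective_part F R y (x2, \<theta>2, \<nu>2)"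
    unfolding lhs rhs using f rs by auto
qed

lemma penalty_part_jensen:
  assumes "penalty r' \<tau>' \<eta>' (u * \<nu>1 + v * \<nu>2) \<le> u * penalty r' \<tau>' \<eta>' \<nu>1 + v * penalty r' \<tau>' \<eta>' \<nu>2"
    and "\<And>i. penalty r (\<tau> $ i) \<eta> (u * \<theta>1 $ i + v * \<theta>2 $ i)
          \<le> u * penalty r (\<tau> $ i) \<eta> (\<theta>1 $ i) + v * penalty r (\<tau> $ i) \<eta> (\<theta>2 $ i)"
  shows "penalty_part r r' \<tau> \<tau>' \<eta> \<eta>' (u *\<^sub>R (x1, \<theta>1, \<nu>1) + v *\<^sub>R (x2, \<theta>2, \<nu>2))
       \<le> u * penalty_part r r' \<tau> \<tau>' \<eta> \<eta>' (x1, \<theta>1, \<nu>1)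
        + v * penalty_part r r' \<tau> \<tau>' \<eta> \<eta>' (x2, \<theta>2, \<nu>2)"
  using add_mono[OF assms(1) sum_mono[OF assms(2), where K = UNIV]]
  by (simp add: penalty_part_def sum.distrib sum_distrib_left algebra_simps)

lemma penalty_part_strict_jensen:
  fixes \<tau> \<theta>1 \<theta>2 :: "real ^ 'k"
  assumes "r \<ge> 1" "r' \<ge> 1" "\<eta> > 0" "\<eta>' > 0" "\<And>i. \<tau> $ i > 0" "\<tau>' > 0"
    and pos: "\<And>i. \<theta>1 $ i > 0" "\<nu>1 > 0" "\<And>i. \<theta>2 $ i > 0" "\<nu>2 > 0"
    and uv: "u > 0" "v > 0" "u + v = 1"
    and ne: "(\<theta>1, \<nu>1) \<noteq> (\<theta>2, \<nu>2)"
  shows "penalty_part r r' \<tau> \<tau>' \<eta> \<eta>' (u *\<^sub>R (x1, \<theta>1, \<nu>1) + v *\<^sub>R (x2, \<theta>2, \<nu>2))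
       < u * penalty_part r r' \<tau> \<tau>' \<eta> \<eta>' (x1, \<theta>1, \<nu>1)
        + v * penalty_part r r' \<tau> \<tau>' \<eta> \<eta>' (x2, \<theta>2, \<nu>2)"
proof -
  have same: "u * w + v * w = w" for w :: real using uv(3) by (simp flip: distrib_right)
  define pl pr where
    "pl i = penalty r (\<tau> $ i) \<eta> (u * \<theta>1 $ i + v * \<theta>2 $ i)" and
    "pr i = u * penalty r (\<tau> $ i) \<eta> (\<theta>1 $ i) + v * penalty r (\<tau> $ i) \<eta> (\<theta>2 $ i)" for i
  define nl nr where
    "nl = penalty r' \<tau>' \<eta>' (u * \<nu>1 + v * \<nu>2)" and
    "nr = u * penalty r' \<tau>' \<eta>' \<nu>1 + v * penalty r' \<tau>' \<eta>' \<nu>2"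
  have n: "\<nu>1 \<noteq> \<nu>2 \<Longrightarrow> nl < nr"
    unfolding nl_def nr_def by (intro penalty_strict_jensen assms)
  have p: "\<theta>1 $ i \<noteq> \<theta>2 $ i \<Longrightarrow> pl i < pr i" for i
    unfolding pl_def pr_def by (intro penalty_strict_jensen assms)
  have n_le: "nl \<le> nr"
    using n by (cases "\<nu>1 = \<nu>2") (auto simp: nl_def nr_def same)
  have p_le: "pl i \<le> pr i" for i
    using p[of i] by (cases "\<theta>1 $ i = \<theta>2 $ i") (auto simp: pl_def pr_def same)
  have ps_le: "sum pl UNIV \<le> sum pr UNIV" using p_le by (intro sum_mono) auto
  have "nl < nr \<or> sum pl UNIV < sum pr UNIV"
  proof (cases "\<nu>1 = \<nu>2")
    case True
    then obtain i where "\<theta>1 $ i \<noteq> \<theta>2 $ i" using ne by (auto simp: vec_eq_iff)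
    from p[OF this] show ?thesis using p_le by (auto intro!: sum_strict_mono_ex1)
  qed (use n in auto)
  then have "nl + sum pl UNIV < nr + sum pr UNIV" using n_le ps_le by auto
  then show ?thesis
    by (simp add: penalty_part_def nl_def nr_def pl_def pr_def sum.distrib sum_distrib_left algebra_simps)
qed

section \<open>Convexity of the objective\<close>

lemma convex_vector_box:
  fixes S :: "'k::finite \<Rightarrow> real set"
  assumes "\<And>i. convex (S i)"
  shows "convex {x :: real ^ 'k. \<forall>i. x $ i \<in> S i}"
  using assms by (simp add: convex_def)

lemma objective_strictly_convex:
  fixes F :: "real ^ 'n ^ 'm" and R :: "real ^ 'n ^ 'k" and y :: "real ^ 'm" and \<tau> :: "real ^ 'k"
  assumes ker: "{x. F *v x = 0} \<inter> {x. R *v x = 0} = {0}"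
    and par: "r \<ge> 1" "r' \<ge> 1" "\<eta> > 0" "\<eta>' > 0" "\<And>i. \<tau> $ i > 0" "\<tau>' > 0"
  shows "globally_strictly_convex (objective F R y r r' \<tau> \<tau>' \<eta> \<eta>')"
  unfolding globally_strictly_convex_def ereal_strictly_convex_on_def effective_domain_objective
proof (intro conjI ballI allI impI)
  have "convex {\<theta> :: real ^ 'k. \<forall>i. \<theta> $ i > 0}"
    using convex_vector_box[of "\<lambda>_. {0<..}"] by simp
  then show "convex ((UNIV :: (real ^ 'n) set) \<times> {\<theta> :: real ^ 'k. \<forall>i. \<theta> $ i > 0} \<times> {0 :: real<..})"
    by (intro convex_Times) auto
  fix z1 z2 :: "(real ^ 'n) \<times> (real ^ 'k) \<times> real" and u v :: real
  assume z: "z1 \<in> UNIV \<times> {\<theta>. \<forall>i. \<theta> $ i > 0} \<times> {0<..}" "z2 \<in> UNIV \<times> {\<theta>. \<forall>i. \<theta> $ i > 0} \<times> {0<..}"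
    and "z1 \<noteq> z2" and uv: "u > 0" "v > 0" "u + v = 1"
  obtain x1 \<theta>1 \<nu>1 x2 \<theta>2 \<nu>2 where z12: "z1 = (x1, \<theta>1, \<nu>1)" "z2 = (x2, \<theta>2, \<nu>2)"
    by (metis prod_cases3)
  then have pos: "\<And>i. \<theta>1 $ i > 0" "\<nu>1 > 0" "\<And>i. \<theta>2 $ i > 0" "\<nu>2 > 0" using z by auto
  let ?A = "perspective_part F R y" and ?P = "penalty_part r r' \<tau> \<tau>' \<eta> \<eta>'"
  have A: "?A (u *\<^sub>R z1 + v *\<^sub>R z2) \<le> u * ?A z1 + v * ?A z2"
    unfolding z12 by (intro perspective_part_jensen pos uv)
  have "?A (u *\<^sub>R z1 + v *\<^sub>R z2) / 2 + ?P (u *\<^sub>R z1 + v *\<^sub>R z2)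
      < u * (?A z1 / 2 + ?P z1) + v * (?A z2 / 2 + ?P z2)"
  proof (cases "(\<theta>1, \<nu>1) = (\<theta>2, \<nu>2)")
    case True
    then have eq: "\<theta>1 = \<theta>2" "\<nu>1 = \<nu>2" by auto
    have "x1 - x2 \<noteq> 0" using True \<open>z1 \<noteq> z2\<close> z12 by auto
    then have "x1 - x2 \<notin> {x. F *v x = 0} \<inter> {x. R *v x = 0}" unfolding ker by blast
    then have "F *v x1 \<noteq> F *v x2 \<or> R *v x1 \<noteq> R *v x2"
      by (auto simp: matrix_vector_mult_diff_distrib)
    then have "?A (u *\<^sub>R z1 + v *\<^sub>R z2) < u * ?A z1 + v * ?A z2"
      unfolding z12 by (intro perspective_part_jensen pos uv eq)
    moreover have "?P (u *\<^sub>R z1 + v *\<^sub>R z2) = u * ?P z1 + v * ?P z2"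
    proof -
      have "u *\<^sub>R w + v *\<^sub>R w = w" for w :: "'a::real_vector"
        using uv(3) by (simp flip: scaleR_left_distrib)
      from this[of \<theta>2] this[of \<nu>2] this[of "?P z2"] show ?thesis
        by (simp add: z12 eq penalty_part_def)
    qed
    ultimately show ?thesis by (simp add: algebra_simps)
  next
    case False
    then have "?P (u *\<^sub>R z1 + v *\<^sub>R z2) < u * ?P z1 + v * ?P z2"
      unfolding z12 by (intro penalty_part_strict_jensen par pos uv)
    then show ?thesis using A by (simp add: algebra_simps)
  qed
  moreover have "\<And>i. (u *\<^sub>R \<theta>1 + v *\<^sub>R \<theta>2) $ i > 0" "u * \<nu>1 + v * \<nu>2 > 0"
    using pos uv by (simp_all add: add_pos_pos)
  ultimately show "objective F R y r r' \<tau> \<tau>' \<eta> \<eta>' (u *\<^sub>R z1 + v *\<^sub>R z2)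
      < ereal u * objective F R y r r' \<tau> \<tau>' \<eta> \<eta>' z1 + ereal v * objective F R y r r' \<tau> \<tau>' \<eta> \<eta>' z2"
    unfolding z12 by (simp add: objective_eq pos)
qed

lemma objective_convex_on_box:
  fixes F :: "real ^ 'n ^ 'm" and R :: "real ^ 'n ^ 'k" and y :: "real ^ 'm" and \<tau> c :: "real ^ 'k"
  assumes p: "\<And>i. convex_on {0<..<c $ i} (penalty r (\<tau> $ i) \<eta>)"
    and p': "convex_on {0<..<c'} (penalty r' \<tau>' \<eta>')"
  shows "ereal_convex_on (UNIV \<times> {\<theta>. \<forall>i. 0 < \<theta> $ i \<and> \<theta> $ i < c $ i} \<times> {0<..<c'})
           (objective F R y r r' \<tau> \<tau>' \<eta> \<eta>')"
  unfolding ereal_convex_on_def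
proof (intro conjI ballI allI impI)
  have "convex {\<theta> :: real ^ 'k. \<forall>i. 0 < \<theta> $ i \<and> \<theta> $ i < c $ i}"
    using convex_vector_box[of "\<lambda>i. {0<..<c $ i}"] by simp
  then show "convex ((UNIV :: (real ^ 'n) set)
      \<times> {\<theta> :: real ^ 'k. \<forall>i. 0 < \<theta> $ i \<and> \<theta> $ i < c $ i} \<times> {0<..<c'})"
    by (intro convex_Times) auto
  fix z1 z2 :: "(real ^ 'n) \<times> (real ^ 'k) \<times> real" and u v :: real
  assume z: "z1 \<in> UNIV \<times> {\<theta>. \<forall>i. 0 < \<theta> $ i \<and> \<theta> $ i < c $ i} \<times> {0<..<c'}"
      "z2 \<in> UNIV \<times> {\<theta>. \<forall>i. 0 < \<theta> $ i \<and> \<theta> $ i < c $ i} \<times> {0<..<c'}"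
    and uv: "u > 0" "v > 0" "u + v = 1"
  obtain x1 \<theta>1 \<nu>1 x2 \<theta>2 \<nu>2 where z12: "z1 = (x1, \<theta>1, \<nu>1)" "z2 = (x2, \<theta>2, \<nu>2)"
    by (metis prod_cases3)
  then have pos: "\<And>i. \<theta>1 $ i > 0" "\<nu>1 > 0" "\<And>i. \<theta>2 $ i > 0" "\<nu>2 > 0" using z by auto
  let ?A = "perspective_part F R y" and ?P = "penalty_part r r' \<tau> \<tau>' \<eta> \<eta>'"
  have "?A (u *\<^sub>R z1 + v *\<^sub>R z2) \<le> u * ?A z1 + v * ?A z2"
    unfolding z12 by (intro perspective_part_jensen pos uv)
  moreover have "?P (u *\<^sub>R z1 + v *\<^sub>R z2) \<le> u * ?P z1 + v * ?P z2"
    unfolding z12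
  proof (rule penalty_part_jensen)
    show "penalty r' \<tau>' \<eta>' (u * \<nu>1 + v * \<nu>2) \<le> u * penalty r' \<tau>' \<eta>' \<nu>1 + v * penalty r' \<tau>' \<eta>' \<nu>2"
      using p' z uv unfolding convex_on_def z12 by auto
    show "penalty r (\<tau> $ i) \<eta> (u * \<theta>1 $ i + v * \<theta>2 $ i)
          \<le> u * penalty r (\<tau> $ i) \<eta> (\<theta>1 $ i) + v * penalty r (\<tau> $ i) \<eta> (\<theta>2 $ i)" for i
      using p[of i] z uv unfolding convex_on_def z12 by auto
  qed
  ultimately have "?A (u *\<^sub>R z1 + v *\<^sub>R z2) / 2 + ?P (u *\<^sub>R z1 + v *\<^sub>R z2)
      \<le> u * (?A z1 / 2 + ?P z1) + v * (?A z2 / 2 + ?P z2)"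
    by (simp add: algebra_simps)
  moreover have "\<And>i. (u *\<^sub>R \<theta>1 + v *\<^sub>R \<theta>2) $ i > 0" "u * \<nu>1 + v * \<nu>2 > 0"
    using pos uv by (simp_all add: add_pos_pos)
  ultimately show "objective F R y r r' \<tau> \<tau>' \<eta> \<eta>' (u *\<^sub>R z1 + v *\<^sub>R z2)
      \<le> ereal u * objective F R y r r' \<tau> \<tau>' \<eta> \<eta>' z1 + ereal v * objective F R y r r' \<tau> \<tau>' \<eta> \<eta>' z2"
    unfolding z12 by (simp add: objective_eq pos)
qed

theorem theorem3p2:
  fixes F :: "real ^ 'n ^ 'm" and R :: "real ^ 'n ^ 'k" and y :: "real ^ 'm"
    and r r' \<beta> \<beta>' \<eta> \<eta>' \<tau>' :: real and \<tau> :: "real ^ 'k"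
  assumes "{x. F *v x = 0} \<inter> {x. R *v x = 0} = {0}"
    and "r \<noteq> 0" and "r' \<noteq> 0"
    and "\<beta> > 0" and "\<beta>' > 0"
    and "\<And>i. \<tau> $ i > 0" and "\<tau>' > 0"
    and "\<eta> = r * \<beta> - 3 / 2"
    and "\<eta>' = r' * \<beta>' - (real CARD('m) + 2) / 2"
  shows "(r \<ge> 1 \<and> r' \<ge> 1 \<and> \<eta> > 0 \<and> \<eta>' > 0 \<longrightarrow>
            globally_strictly_convex (objective F R y r r' \<tau> \<tau>' \<eta> \<eta>'))
       \<and> (((0 < r \<and> r < 1 \<and> \<eta> > 0) \<or> r < 0) \<and> ((0 < r' \<and> r' < 1 \<and> \<eta>' > 0) \<or> r' < 0) \<longrightarrow>
            (\<forall>x \<theta> \<nu>. (\<forall>i. \<theta> $ i > 0) \<and> \<nu> > 0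
               \<and> (\<forall>i. \<theta> $ i < \<tau> $ i * (\<eta> / (r * \<bar>r - 1\<bar>)) powr (1 / r))
               \<and> \<nu> < \<tau>' * (\<eta>' / (r' * \<bar>r' - 1\<bar>)) powr (1 / r') \<longrightarrow>
               locally_convex_at (objective F R y r r' \<tau> \<tau>' \<eta> \<eta>') (x, \<theta>, \<nu>)))"
proof (intro conjI impI allI)
  assume "r \<ge> 1 \<and> r' \<ge> 1 \<and> \<eta> > 0 \<and> \<eta>' > 0"
  then show "globally_strictly_convex (objective F R y r r' \<tau> \<tau>' \<eta> \<eta>')"
    using assms(6,7) by (intro objective_strictly_convex assms(1)) auto
next
  fix x :: "real ^ 'n" and \<theta> :: "real ^ 'k" and \<nu> :: real
  assume rr: "((0 < r \<and> r < 1 \<and> \<eta> > 0) \<or> r < 0) \<and> ((0 < r' \<and> r' < 1 \<and> \<eta>' > 0) \<or> r' < 0)"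
    and bounds: "(\<forall>i. \<theta> $ i > 0) \<and> \<nu> > 0
               \<and> (\<forall>i. \<theta> $ i < \<tau> $ i * (\<eta> / (r * \<bar>r - 1\<bar>)) powr (1 / r))
               \<and> \<nu> < \<tau>' * (\<eta>' / (r' * \<bar>r' - 1\<bar>)) powr (1 / r')"
  \<comment> \<open>For a negative exponent the parametrisation of \<open>\<eta>\<close> and \<open>\<eta>'\<close> through \<open>\<beta>\<close> and \<open>\<beta>'\<close>
    forces them to be negative as well.\<close>
  have "r < 0 \<Longrightarrow> \<eta> < 0" "r' < 0 \<Longrightarrow> \<eta>' < 0"
    using mult_neg_pos[of r \<beta>] mult_neg_pos[of r' \<beta>'] assms(4,5,8,9) by auto
  with rr have r: "(0 < r \<and> r < 1 \<and> \<eta> > 0) \<or> (r < 0 \<and> \<eta> < 0)"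
    and r': "(0 < r' \<and> r' < 1 \<and> \<eta>' > 0) \<or> (r' < 0 \<and> \<eta>' < 0)" by auto
  define c where "c = (\<chi> i. \<tau> $ i * (\<eta> / (r * \<bar>r - 1\<bar>)) powr (1 / r))"
  define c' where "c' = \<tau>' * (\<eta>' / (r' * \<bar>r' - 1\<bar>)) powr (1 / r')"
  define U where
    "U = (UNIV :: (real ^ 'n) set) \<times> {\<theta>. \<forall>i. 0 < \<theta> $ i \<and> \<theta> $ i < c $ i} \<times> {0<..<c'}"
  have "ereal_convex_on U (objective F R y r r' \<tau> \<tau>' \<eta> \<eta>')"
    unfolding U_def
  proof (rule objective_convex_on_box)
    show "convex_on {0<..<c $ i} (penalty r (\<tau> $ i) \<eta>)" for i
      unfolding c_def using convex_on_penalty_below_threshold[OF r assms(6)] by simp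
    show "convex_on {0<..<c'} (penalty r' \<tau>' \<eta>')"
      unfolding c'_def by (rule convex_on_penalty_below_threshold[OF r' assms(7)])
  qed
  moreover have "open {\<theta>. \<forall>i. 0 < \<theta> $ i \<and> \<theta> $ i < c $ i}"
    using open_vector_box[of "\<lambda>i. {0<..<c $ i}"] by simp
  then have "open U" unfolding U_def by (intro open_Times) auto
  moreover have "(x, \<theta>, \<nu>) \<in> U" using bounds by (simp add: U_def c_def c'_def)
  ultimately show "locally_convex_at (objective F R y r r' \<tau> \<tau>' \<eta> \<eta>') (x, \<theta>, \<nu>)"
    unfolding locally_convex_at_def by blast
qed

end
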